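(* Let $G=(V,E)$ and $G'=(V',E')$ be irreflexive directed graphs, and let $Q_G$ and $Q_{G'}$ be their associated keis. Then $G\cong G'$ (as directed graphs) if and only if $Q_G\cong Q_{G'}$ (as keis).
   Context: An irreflexive directed graph $G=(V,E)$ consists of a vertex set $V$ and a relation $E\subseteq V\times V$ such that $v\mathrel{E}v$ holds for no $v\in V$. A graph isomorphism from $(V,E)$ to $(V',E')$ is a bijection $h\colon V\to V'$ such that for all $u,v\in V$, $u\mathrel{E}v$ if and only if $h(u)\mathrel{E'}h(v)$. A kei is a set $A$ with a binary operation $*$ such that: (i) $a*(b*c)=(a*b)*(a*c)$ for all $a,b,c\in A$; (ii) for all $a,c\in A$ there is a unique $b\in A$ with $a*b=c$; (iii) $a*a=a$ for all $a\in A$; (iv) $a*(a*b)=b$ for all $a,b\in A$. An isomorphism of keis is a bijection preserving the operation $*$. For an irreflexive directed graph $G=(V,E)$, the kei $Q_G$ associated to $G$ has underlying set $V\times\{0,1\}$ and operation $$(u,i)*(v,j)=\begin{cases}(v,j)&\text{if } u\mathrel{E}v \text{ or } u=v,\\ (v,1-j)&\text{otherwise,}\end{cases}$$ for $u,v\in V$ and $i,j\in\{0,1\}$. (This is a kei.) *)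

theory Defs
  imports Main
begin

locale irreflexive_digraph =
  fixes V :: "'a set" and E :: "('a \<times> 'a) set"
  assumes edges_subset: "E \<subseteq> V \<times> V"
    and no_loops: "irrefl E"

definition digraph_isomorphism ::
  "'a set \<Rightarrow> ('a \<times> 'a) set \<Rightarrow> 'b set \<Rightarrow> ('b \<times> 'b) set \<Rightarrow> ('a \<Rightarrow> 'b) \<Rightarrow> bool" where
  "digraph_isomorphism V E V' E' h \<longleftrightarrow>
     bij_betw h V V' \<and> (\<forall>u\<in>V. \<forall>v\<in>V. (u, v) \<in> E \<longleftrightarrow> (h u, h v) \<in> E')"

definition digraph_isomorphic ::
  "'a set \<Rightarrow> ('a \<times> 'a) set \<Rightarrow> 'b set \<Rightarrow> ('b \<times> 'b) set \<Rightarrow> bool" where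
  "digraph_isomorphic V E V' E' \<longleftrightarrow> (\<exists>h. digraph_isomorphism V E V' E' h)"

locale kei =
  fixes A :: "'a set" and op :: "'a \<Rightarrow> 'a \<Rightarrow> 'a"  (infixl \<open>\<star>\<close> 70)
  assumes closed: "a \<in> A \<Longrightarrow> b \<in> A \<Longrightarrow> a \<star> b \<in> A"
    and left_distrib: "a \<in> A \<Longrightarrow> b \<in> A \<Longrightarrow> c \<in> A \<Longrightarrow> a \<star> (b \<star> c) = (a \<star> b) \<star> (a \<star> c)"
    and left_solvable: "a \<in> A \<Longrightarrow> c \<in> A \<Longrightarrow> \<exists>!b. b \<in> A \<and> a \<star> b = c"
    and idem: "a \<in> A \<Longrightarrow> a \<star> a = a"
    and left_involutive: "a \<in> A \<Longrightarrow> b \<in> A \<Longrightarrow> a \<star> (a \<star> b) = b"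

definition kei_isomorphism ::
  "'a set \<Rightarrow> ('a \<Rightarrow> 'a \<Rightarrow> 'a) \<Rightarrow> 'b set \<Rightarrow> ('b \<Rightarrow> 'b \<Rightarrow> 'b) \<Rightarrow> ('a \<Rightarrow> 'b) \<Rightarrow> bool" where
  "kei_isomorphism A op A' op' f \<longleftrightarrow>
     kei A op \<and> kei A' op' \<and> bij_betw f A A' \<and>
     (\<forall>a\<in>A. \<forall>b\<in>A. f (op a b) = op' (f a) (f b))"

definition kei_isomorphic ::
  "'a set \<Rightarrow> ('a \<Rightarrow> 'a \<Rightarrow> 'a) \<Rightarrow> 'b set \<Rightarrow> ('b \<Rightarrow> 'b \<Rightarrow> 'b) \<Rightarrow> bool" where
  "kei_isomorphic A op A' op' \<longleftrightarrow> (\<exists>f. kei_isomorphism A op A' op' f)"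

definition graph_kei_carrier :: "'a set \<Rightarrow> ('a \<times> nat) set" where
  "graph_kei_carrier V = V \<times> {0, 1}"

text \<open>The subtraction below is only meaningful for second components in \<open>{0, 1}\<close>,
  that is, on the carrier.\<close>

fun graph_kei_op :: "('a \<times> 'a) set \<Rightarrow> 'a \<times> nat \<Rightarrow> 'a \<times> nat \<Rightarrow> 'a \<times> nat" where
  "graph_kei_op E (u, i) (v, j) = (if (u, v) \<in> E \<or> u = v then (v, j) else (v, 1 - j))"

lemma kei_graph_kei: "kei (graph_kei_carrier V) (graph_kei_op E)"
proof
  fix a c assume ac: "a \<in> graph_kei_carrier V" "c \<in> graph_kei_carrier V"
  have "\<And>b. b \<in> graph_kei_carrier V \<Longrightarrow> graph_kei_op E a (graph_kei_op E a b) = b"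
    using ac by (cases a) (auto simp: graph_kei_carrier_def)
  moreover have "graph_kei_op E a c \<in> graph_kei_carrier V"
    using ac by (cases a) (auto simp: graph_kei_carrier_def)
  ultimately show "\<exists>!b. b \<in> graph_kei_carrier V \<and> graph_kei_op E a b = c"
    using ac by metis
qed (auto simp: graph_kei_carrier_def)

end

theory Submission imports Defs begin

text \<open>Write \<open>u \<rightarrow> v\<close> for "\<open>(u, v) \<in> E\<close> or \<open>u = v\<close>".  On the carrier, \<open>a\<close> fixes \<open>b\<close> under the
  kei operation exactly when \<open>fst a \<rightarrow> fst b\<close>, so a kei isomorphism \<open>f\<close> preserves this relation
  between first components.  What \<open>f\<close> need not preserve is the pairing of \<open>(v, 0)\<close> with
  \<open>(v, 1)\<close>, so it does not directly induce a map on vertices.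

  The way out is to work with twin classes: call two vertices twins if they have the same
  \<open>\<rightarrow>\<close>-predecessors and the same \<open>\<rightarrow>\<close>-successors.  Twinness of first components is expressed by
  fixing alone, so \<open>f\<close> carries \<open>C \<times> {0, 1}\<close> onto \<open>C' \<times> {0, 1}\<close> for matching twin classes \<open>C\<close>
  and \<open>C'\<close>.  Doubling can be cancelled from an equality of cardinals, finite or
  infinite (\<open>bij_betw_cancel_double\<close>), hence \<open>C\<close> and \<open>C'\<close> are in bijection.  Gluing arbitrary
  bijections between matching classes gives a bijection of the vertex sets, and it preserves
  \<open>\<rightarrow>\<close> because \<open>\<rightarrow>\<close> cannot distinguish twins (\<open>relation_iso_of_doubled_iso\<close>).  Since the graphs
  have no loops, \<open>\<rightarrow>\<close> determines the edges.  The other direction of the theorem applies a graph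
  isomorphism to first components.\<close>

section \<open>Cancelling a factor two\<close>

text \<open>For finite sets this is division by two; an infinite set absorbs the factor.\<close>

lemma bij_betw_cancel_double:
  includes cardinal_syntax
  fixes A :: "'a set" and B :: "'b set"
  assumes "bij_betw f (A \<times> {0, 1::nat}) (B \<times> {0, 1::nat})"
  shows "\<exists>k. bij_betw k A B"
proof (cases "finite A")
  case True
  have "finite (B \<times> {0, 1::nat})"
    using assms True by (metis bij_betw_finite finite.emptyI finite.insertI finite_SigmaI)
  then have "finite B"
    by (auto simp: finite_cartesian_product_iff)
  moreover have "card A = card B"
    using bij_betw_same_card[OF assms] by (simp add: card_cartesian_product)
  ultimately show ?thesis
    using True by (metis finite_same_card_bij)
next
  case False
  have absorb: "|C \<times> {0, 1::nat}| =o |C|" if "infinite C" for C :: "'c set"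
  proof -
    have "|{0, 1::nat}| \<le>o |C|"
      using that
      by (intro ordLess_imp_ordLeq finite_ordLess_infinite card_of_Well_order)
        (auto simp: Field_card_of)
    then show ?thesis
      by (rule card_of_Times_infinite_simps(1)[OF that insert_not_empty])
  qed
  have "infinite (B \<times> {0, 1::nat})"
    using bij_betw_finite[OF assms] False by (auto simp: finite_cartesian_product_iff)
  then have "infinite B"
    by (simp add: finite_cartesian_product_iff)
  have "|A \<times> {0, 1::nat}| =o |B \<times> {0, 1::nat}|"
    using assms card_of_ordIso by blast
  then have "|A| =o |B|"
    using absorb[OF False] absorb[OF \<open>infinite B\<close>]
    by (meson ordIso_symmetric ordIso_transitive)
  then show ?thesis
    using card_of_ordIso by blast
qed

section \<open>Twin classes\<close>

definition twins :: "'a set \<Rightarrow> ('a \<Rightarrow> 'a \<Rightarrow> bool) \<Rightarrow> 'a \<Rightarrow> 'a \<Rightarrow> bool" where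
  "twins V R u v \<longleftrightarrow> (\<forall>w\<in>V. (R u w \<longleftrightarrow> R v w) \<and> (R w u \<longleftrightarrow> R w v))"

definition twin_class :: "'a set \<Rightarrow> ('a \<Rightarrow> 'a \<Rightarrow> bool) \<Rightarrow> 'a \<Rightarrow> 'a set" where
  "twin_class V R v = {u \<in> V. twins V R u v}"

lemma twins_refl: "twins V R u u"
  by (simp add: twins_def)

lemma twin_class_eq_iff:
  assumes "u \<in> V" "v \<in> V"
  shows "twin_class V R u = twin_class V R v \<longleftrightarrow> twins V R u v"
  using assms unfolding twin_class_def twins_def by blast

text \<open>A bijection of the doubled sets that respects the relation on first components induces
  a map of twin classes only; a map of points is recovered by choosing one bijection for each
  class.\<close>

lemma relation_iso_of_doubled_iso:
  fixes V :: "'a set" and V' :: "'b set"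
  assumes bij: "bij_betw f (V \<times> {0, 1::nat}) (V' \<times> {0, 1::nat})"
    and rel: "\<And>a b. a \<in> V \<times> {0, 1} \<Longrightarrow> b \<in> V \<times> {0, 1} \<Longrightarrow>
               R (fst a) (fst b) \<longleftrightarrow> R' (fst (f a)) (fst (f b))"
  shows "\<exists>h. bij_betw h V V' \<and> (\<forall>u\<in>V. \<forall>v\<in>V. R u v \<longleftrightarrow> R' (h u) (h v))"
proof -
  let ?D = "V \<times> {0, 1::nat}" and ?D' = "V' \<times> {0, 1::nat}"
  have surj: "\<exists>a\<in>?D. f a = b" if "b \<in> ?D'" for b
  proof -
    have "b \<in> f ` ?D"
      unfolding bij_betw_imp_surj_on[OF bij] by (rule that)
    then show ?thesis
      by (elim imageE) (rule bexI, rule sym)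
  qed
  have f_in: "fst (f a) \<in> V'" if "a \<in> ?D" for a
    using bij_betw_apply[OF bij that] unfolding mem_Times_iff by (rule conjunct1)
  have twins_iff: "twins V R (fst a) (fst b) \<longleftrightarrow> twins V' R' (fst (f a)) (fst (f b))"
    if a: "a \<in> ?D" and b: "b \<in> ?D" for a b
  proof
    assume tw: "twins V R (fst a) (fst b)"
    show "twins V' R' (fst (f a)) (fst (f b))"
      unfolding twins_def
    proof
      fix w assume "w \<in> V'"
      then obtain c where c: "c \<in> ?D" "f c = (w, 0)"
        using surj[of "(w, 0)"] by auto
      then have "fst c \<in> V" by auto
      then show "(R' (fst (f a)) w \<longleftrightarrow> R' (fst (f b)) w) \<and>
                 (R' w (fst (f a)) \<longleftrightarrow> R' w (fst (f b)))"
        using tw rel[OF a c(1)] rel[OF b c(1)] rel[OF c(1) a] rel[OF c(1) b] c(2)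
        by (simp add: twins_def)
    qed
  next
    assume tw: "twins V' R' (fst (f a)) (fst (f b))"
    show "twins V R (fst a) (fst b)"
      unfolding twins_def
    proof
      fix w assume "w \<in> V"
      then have c: "(w, 0) \<in> ?D" by simp
      show "(R (fst a) w \<longleftrightarrow> R (fst b) w) \<and> (R w (fst a) \<longleftrightarrow> R w (fst b))"
        using tw rel[OF a c] rel[OF b c] rel[OF c a] rel[OF c b] f_in[OF c]
        by (simp add: twins_def)
    qed
  qed
  \<comment> \<open>\<open>g\<close> may be neither injective nor surjective; it only serves to name the twin class
    that corresponds to the class of \<open>v\<close>.\<close>
  define g where "g v = fst (f (v, 0))" for v
  define C where "C = twin_class V R"
  define C' where "C' v = twin_class V' R' (g v)" for v
  have g_in: "g v \<in> V'" if "v \<in> V" for v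
    unfolding g_def using that by (intro f_in) auto
  have C_in: "v \<in> C v" if "v \<in> V" for v
    using that by (simp add: C_def twin_class_def twins_refl)
  have C_eq: "C u = C v \<longleftrightarrow> twins V R u v" if "u \<in> V" "v \<in> V" for u v
    unfolding C_def by (rule twin_class_eq_iff[OF that])
  have C'_eq: "C' u = C' v \<longleftrightarrow> C u = C v" if uv: "u \<in> V" "v \<in> V" for u v
    using C_eq[OF uv] twin_class_eq_iff[OF g_in[OF uv(1)] g_in[OF uv(2)]]
      twins_iff[of "(u, 0)" "(v, 0)"] uv
    by (simp add: C'_def g_def)
  have mem_C: "a \<in> C v \<times> {0, 1} \<longleftrightarrow> a \<in> ?D \<and> twins V R (fst a) v" for a v
    by (auto simp: C_def twin_class_def)
  have mem_C': "b \<in> C' v \<times> {0, 1} \<longleftrightarrow> b \<in> ?D' \<and> twins V' R' (fst b) (g v)" for b v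
    by (auto simp: C'_def twin_class_def)
  have transfer: "f a \<in> C' v \<times> {0, 1} \<longleftrightarrow> a \<in> C v \<times> {0, 1}" if "a \<in> ?D" "v \<in> V" for a v
    unfolding mem_C mem_C'
    using that twins_iff[of a "(v, 0)"] bij_betw_apply[OF bij that(1)] by (simp add: g_def)
  have double: "f ` (C v \<times> {0, 1}) = C' v \<times> {0, 1}" if v: "v \<in> V" for v
  proof (intro subset_antisym subsetI)
    fix b assume "b \<in> f ` (C v \<times> {0, 1})"
    then obtain a where a: "a \<in> C v \<times> {0, 1}" "b = f a"
      by (rule imageE)
    moreover have "a \<in> ?D"
      using a(1) unfolding mem_C by (rule conjunct1)
    ultimately show "b \<in> C' v \<times> {0, 1}"
      using transfer v by simp
  next
    fix b :: "'b \<times> nat"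
    assume b: "b \<in> C' v \<times> {0, 1}"
    then have "b \<in> ?D'"
      unfolding mem_C' by (rule conjunct1)
    then obtain a where a: "a \<in> ?D" "f a = b"
      by (elim bexE[OF surj])
    then have "a \<in> C v \<times> {0, 1}"
      using transfer[OF a(1) v] b by simp
    then show "b \<in> f ` (C v \<times> {0, 1})"
      using a(2) by (rule rev_image_eqI[OF _ sym])
  qed
  have class_bij: "\<exists>k. bij_betw k (C v) (C' v)" if "v \<in> V" for v
  proof (rule bij_betw_cancel_double)
    have "C v \<times> {0, 1} \<subseteq> ?D"
      by (auto simp: C_def twin_class_def)
    then show "bij_betw f (C v \<times> {0, 1}) (C' v \<times> {0, 1})"
      by (rule bij_betw_subset[OF bij _ double[OF that]])
  qed
  \<comment> \<open>The bijection is chosen as a function of the two classes, so twins use the same one.\<close>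
  define k where "k v = (SOME k. bij_betw k (C v) (C' v))" for v
  define h where "h v = k v v" for v
  have k_bij: "bij_betw (k v) (C v) (C' v)" if "v \<in> V" for v
    unfolding k_def using class_bij[OF that] by (rule someI_ex)
  have k_eq: "k u = k v" if "u \<in> V" "v \<in> V" "C u = C v" for u v
    using that(3) iffD2[OF C'_eq[OF that(1,2)] that(3)] by (simp add: k_def)
  have h_in: "h v \<in> C' v" if "v \<in> V" for v
    unfolding h_def using k_bij[OF that] C_in[OF that] by (meson bij_betwE)
  have h_V': "h v \<in> V'" and h_twins: "twins V' R' (h v) (g v)" if "v \<in> V" for v
    using h_in[OF that] by (simp_all add: C'_def twin_class_def)
  have "inj_on h V"
  proof (rule inj_onI)
    fix u v assume uv: "u \<in> V" "v \<in> V" "h u = h v"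
    then have "twins V' R' (g u) (g v)"
      using h_twins[of u] h_twins[of v] by (simp add: twins_def)
    then have "C u = C v"
      using C'_eq[of u v] twin_class_eq_iff[of "g u" V' "g v" R'] g_in uv by (simp add: C'_def)
    then show "u = v"
      using k_eq[of u v] k_bij[of u] C_in uv unfolding h_def bij_betw_def inj_on_def by metis
  qed
  moreover have "h ` V = V'"
  proof
    show "h ` V \<subseteq> V'"
      using h_V' by blast
    show "V' \<subseteq> h ` V"
    proof
      fix w assume w: "w \<in> V'"
      then obtain a where a: "a \<in> ?D" "f a = (w, 0)"
        using surj[of "(w, 0)"] by auto
      define u where "u = fst a"
      have u: "u \<in> V"
        using a by (auto simp: u_def)
      have "twins V' R' w (g u)"
        using twins_iff[of a "(u, 0)"] a u by (simp add: g_def u_def twins_refl)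
      then have "w \<in> C' u"
        using w by (simp add: C'_def twin_class_def)
      then obtain x where x: "x \<in> C u" "k u x = w"
        using k_bij[OF u] by (metis bij_betw_imp_surj_on imageE)
      then have "x \<in> V" "C x = C u"
        using C_eq[of x u] u by (auto simp: C_def twin_class_def)
      then have "h x = w"
        using k_eq[of x u] u x(2) by (simp add: h_def)
      then show "w \<in> h ` V"
        using \<open>x \<in> V\<close> by blast
    qed
  qed
  moreover have "R u v \<longleftrightarrow> R' (h u) (h v)" if uv: "u \<in> V" "v \<in> V" for u v
  proof -
    have "R u v \<longleftrightarrow> R' (g u) (g v)"
      using rel[of "(u, 0)" "(v, 0)"] uv by (simp add: g_def)
    also have "\<dots> \<longleftrightarrow> R' (h u) (g v)"
      using h_twins[OF uv(1)] g_in[OF uv(2)] by (simp add: twins_def)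
    also have "\<dots> \<longleftrightarrow> R' (h u) (h v)"
      using h_twins[OF uv(2)] h_V'[OF uv(1)] by (simp add: twins_def)
    finally show ?thesis .
  qed
  ultimately show ?thesis
    unfolding bij_betw_def by blast
qed

section \<open>Graphs and their keis\<close>

text \<open>The action of \<open>a\<close> on \<open>b\<close> is either trivial or swaps the second component of \<open>b\<close>, which has
  no fixed point on \<open>{0, 1}\<close>.\<close>

lemma graph_kei_op_fixes_iff:
  assumes "b \<in> graph_kei_carrier V"
  shows "graph_kei_op E a b = b \<longleftrightarrow> (fst a, fst b) \<in> E \<or> fst a = fst b"
  using assms by (cases a; cases b) (auto simp: graph_kei_carrier_def)

lemma kei_isomorphic_if_digraph_isomorphic:
  assumes "digraph_isomorphic V E V' E'"
  shows "kei_isomorphic (graph_kei_carrier V) (graph_kei_op E)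
                        (graph_kei_carrier V') (graph_kei_op E')"
proof -
  obtain h where bij: "bij_betw h V V'"
    and edges: "\<And>u v. u \<in> V \<Longrightarrow> v \<in> V \<Longrightarrow> (u, v) \<in> E \<longleftrightarrow> (h u, h v) \<in> E'"
    using assms unfolding digraph_isomorphic_def digraph_isomorphism_def by blast
  have inj: "h u = h v \<longleftrightarrow> u = v" if "u \<in> V" "v \<in> V" for u v
    using bij that by (meson bij_betw_imp_inj_on inj_on_eq_iff)
  let ?f = "map_prod h (id :: nat \<Rightarrow> nat)"
  have "bij_betw ?f (graph_kei_carrier V) (graph_kei_carrier V')"
    unfolding graph_kei_carrier_def using bij by (intro bij_betw_map_prod) auto
  moreover have "?f (graph_kei_op E a b) = graph_kei_op E' (?f a) (?f b)"
    if "a \<in> graph_kei_carrier V" "b \<in> graph_kei_carrier V" for a b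
    using that edges inj by (cases a; cases b) (auto simp: graph_kei_carrier_def)
  ultimately have "kei_isomorphism (graph_kei_carrier V) (graph_kei_op E)
      (graph_kei_carrier V') (graph_kei_op E') ?f"
    unfolding kei_isomorphism_def by (simp add: kei_graph_kei)
  then show ?thesis
    unfolding kei_isomorphic_def by blast
qed

lemma digraph_isomorphic_if_kei_isomorphic:
  assumes "irreflexive_digraph V E" "irreflexive_digraph V' E'"
    and "kei_isomorphic (graph_kei_carrier V) (graph_kei_op E)
                        (graph_kei_carrier V') (graph_kei_op E')"
  shows "digraph_isomorphic V E V' E'"
proof -
  let ?A = "graph_kei_carrier V" and ?A' = "graph_kei_carrier V'"
  obtain f where bij: "bij_betw f ?A ?A'"
    and hom: "\<And>a b. a \<in> ?A \<Longrightarrow> b \<in> ?A \<Longrightarrow> f (graph_kei_op E a b) = graph_kei_op E' (f a) (f b)"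
    using assms(3) unfolding kei_isomorphic_def kei_isomorphism_def by blast
  define R where "R u v \<longleftrightarrow> (u, v) \<in> E \<or> u = v" for u v
  define R' where "R' u v \<longleftrightarrow> (u, v) \<in> E' \<or> u = v" for u v
  have rel: "R (fst a) (fst b) \<longleftrightarrow> R' (fst (f a)) (fst (f b))"
    if a: "a \<in> ?A" and b: "b \<in> ?A" for a b
  proof -
    have "graph_kei_op E a b \<in> ?A"
      using kei.closed[OF kei_graph_kei a b] .
    then have "graph_kei_op E a b = b \<longleftrightarrow> f (graph_kei_op E a b) = f b"
      using bij b by (metis bij_betw_imp_inj_on inj_on_eq_iff)
    moreover have "f b \<in> ?A'"
      using bij b by (meson bij_betwE)
    ultimately show ?thesis
      using graph_kei_op_fixes_iff[OF b] graph_kei_op_fixes_iff[of "f b" V'] hom[OF a b]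
      by (simp add: R_def R'_def)
  qed
  obtain h where h: "bij_betw h V V'"
    and R_h: "\<And>u v. u \<in> V \<Longrightarrow> v \<in> V \<Longrightarrow> R u v \<longleftrightarrow> R' (h u) (h v)"
    using relation_iso_of_doubled_iso[of f V V' R R'] bij rel
    unfolding graph_kei_carrier_def by blast
  have "(u, v) \<in> E \<longleftrightarrow> (h u, h v) \<in> E'" if uv: "u \<in> V" "v \<in> V" for u v
  proof (cases "u = v")
    case True
    then show ?thesis
      using assms(1,2) by (simp add: irreflexive_digraph_def irrefl_def)
  next
    case False
    then have "h u \<noteq> h v"
      using h uv by (metis bij_betw_imp_inj_on inj_on_eq_iff)
    then show ?thesis
      using R_h[OF uv] False by (simp add: R_def R'_def)
  qed
  then show ?thesis
    unfolding digraph_isomorphic_def digraph_isomorphism_def using h by blast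
qed

theorem theorem3:
  fixes V :: "'a set" and E :: "('a \<times> 'a) set"
    and V' :: "'b set" and E' :: "('b \<times> 'b) set"
  assumes "irreflexive_digraph V E" and "irreflexive_digraph V' E'"
  shows "digraph_isomorphic V E V' E' \<longleftrightarrow>
    kei_isomorphic (graph_kei_carrier V) (graph_kei_op E)
                   (graph_kei_carrier V') (graph_kei_op E')"
  using kei_isomorphic_if_digraph_isomorphic digraph_isomorphic_if_kei_isomorphic[OF assms]
  by blast

end
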